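(* Let $f:\mathbb{R}^n\to\mathbb{R}$ be convex and $L$-smooth, with a minimizer $x^*$ and $f^*=f(x^* )$. Let $\alpha,p\in\mathbb{R}$ satisfy $\alpha\le 2$ and $p+\alpha\ge 2$, let $T_0>0$, and let $X$ be a solution on $[T_0,\infty)$ of $$\ddot{X}(t)+\frac{p+1}{t}\dot{X}(t)+\frac{p+1}{t^\alpha}\nabla f(X(t))=0.$$ Then for any $T>T_0$, $$f(X(T))-f^*\le\frac{\mathcal{E}(T_0)}{2(p+1)T^{2-\alpha}},$$ where $$\mathcal{E}(t)=\left\|pX(t)+t\dot{X}(t)-px^*\right\|^2+2(p+1)t^{2-\alpha}\left(f(X(t))-f^*\right).$$
   Context: $\|\cdot\|$ is the Euclidean norm. $f$ is $L$-smooth if it is differentiable and $\|\nabla f(x)-\nabla f(y)\|\le L\|x-y\|$ for all $x,y\in\mathbb{R}^n$. Dots denote derivatives in $t$. *)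

theory Defs
  imports "HOL-Analysis.Analysis"
begin

definition grad :: "('a::real_inner \<Rightarrow> real) \<Rightarrow> 'a \<Rightarrow> 'a" where
  "grad f x = (THE D. GDERIV f x :> D)"

definition L_smooth :: "real \<Rightarrow> ('a::real_inner \<Rightarrow> real) \<Rightarrow> bool" where
  "L_smooth L f \<longleftrightarrow>
     (\<forall>x. f differentiable (at x)) \<and>
     (\<forall>x y. norm (grad f x - grad f y) \<le> L * norm (x - y))"

text \<open>
  Time derivative of a curve on the half-line from \<open>T0\<close> on: one-sided at \<open>T0\<close>, and the
  usual two-sided derivative at later times. Values of the curve before \<open>T0\<close> play no role.
\<close>
definition time_deriv :: "real \<Rightarrow> (real \<Rightarrow> 'a::real_normed_vector) \<Rightarrow> real \<Rightarrow> 'a" where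
  "time_deriv T0 X t = vector_derivative X (at t within {T0..})"

definition ode_solution ::
  "real \<Rightarrow> real \<Rightarrow> ('a::real_inner \<Rightarrow> real) \<Rightarrow> real \<Rightarrow> (real \<Rightarrow> 'a) \<Rightarrow> bool" where
  "ode_solution \<alpha> p f T0 X \<longleftrightarrow>
     X differentiable_on {T0..} \<and>
     time_deriv T0 X differentiable_on {T0..} \<and>
     (\<forall>t\<ge>T0. time_deriv T0 (time_deriv T0 X) t
               + ((p + 1) / t) *\<^sub>R time_deriv T0 X t
               + ((p + 1) / t powr \<alpha>) *\<^sub>R grad f (X t) = 0)"

definition energy ::
  "real \<Rightarrow> real \<Rightarrow> ('a::real_inner \<Rightarrow> real) \<Rightarrow> 'a \<Rightarrow> real \<Rightarrow> (real \<Rightarrow> 'a) \<Rightarrow> real \<Rightarrow> real" where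
  "energy \<alpha> p f xs T0 X t =
     (norm (p *\<^sub>R X t + t *\<^sub>R time_deriv T0 X t - p *\<^sub>R xs))\<^sup>2
     + 2 * (p + 1) * t powr (2 - \<alpha>) * (f (X t) - f xs)"

end

theory Submission
  imports Defs
begin

text \<open>
  The energy is a Lyapunov function: it is nonincreasing along the trajectory. Write
  \<open>V(t) = p X(t) + t X'(t) - p x*\<close>. The damping coefficient \<open>(p + 1) / t\<close> is exactly what makes
  \<open>V' = (p + 1) X' + t X''\<close> collapse to \<open>-(p + 1) t\<^sup>1\<^sup>-\<^sup>\<alpha> \<nabla>f(X)\<close>, free of velocities. In
  \<open>(\<parallel>V\<parallel>\<^sup>2)' = 2 \<langle>V, V'\<rangle>\<close> the remaining velocity term \<open>t \<langle>X', \<nabla>f(X)\<rangle>\<close> then cancels against the one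
  that comes from differentiating \<open>f(X)\<close>, and what is left is
  \<open>2 (p + 1) t\<^sup>1\<^sup>-\<^sup>\<alpha> ((2 - \<alpha>) (f(X) - f*) - p \<langle>\<nabla>f(X), X - x*\<rangle>)\<close>.
  Convexity gives \<open>\<langle>\<nabla>f(X), X - x*\<rangle> \<ge> f(X) - f* \<ge> 0\<close>, so \<open>p \<ge> 2 - \<alpha> \<ge> 0\<close> makes this nonpositive.

  The stated bound is \<open>\<E>(T) \<le> \<E>(T0)\<close> after dropping the square from \<open>\<E>(T)\<close>.
\<close>

text \<open>
  The gradient is a definite description. A vector representing the derivative exists because a
  linear functional on a Euclidean space is an inner product with a fixed vector, the image of 1
  under its adjoint; it is unique because inner products separate vectors.
\<close>
lemma GDERIV_grad:
  fixes f :: "'a::euclidean_space \<Rightarrow> real"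
  assumes "f differentiable (at x)"
  shows "GDERIV f x :> grad f x"
proof -
  from assms obtain D where D: "(f has_derivative D) (at x)"
    unfolding differentiable_def by blast
  have "D = (\<lambda>h. h \<bullet> adjoint D 1)"
    using adjoint_works[OF has_derivative_linear[OF D], of _ 1] by (simp add: fun_eq_iff)
  with D have D': "GDERIV f x :> adjoint D 1"
    unfolding gderiv_def by metis
  have "E = adjoint D 1" if "GDERIV f x :> E" for E
  proof -
    have "(\<lambda>h. h \<bullet> E) = (\<lambda>h. h \<bullet> adjoint D 1)"
      using that D' unfolding gderiv_def by (rule has_derivative_unique)
    then show ?thesis
      by (metis vector_eq_ldot)
  qed
  with D' show ?thesis
    unfolding grad_def by (rule theI)
qed

lemma GDERIV_has_real_derivative_compose:
  fixes f :: "'a::real_inner \<Rightarrow> real"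
  assumes "GDERIV f (X t) :> D" and "(X has_vector_derivative X') (at t within S)"
  shows "((\<lambda>t. f (X t)) has_real_derivative X' \<bullet> D) (at t within S)"
proof -
  have "((\<lambda>t. f (X t)) has_derivative (\<lambda>s. (s *\<^sub>R X') \<bullet> D)) (at t within S)"
    using assms has_derivative_compose unfolding gderiv_def has_vector_derivative_def by blast
  then show ?thesis
    by (simp add: has_field_derivative_def mult_commute_abs)
qed

text \<open>
  Restricting to the line through \<open>x\<close> and \<open>y\<close> reduces the claim to a convex function of one real
  variable, which lies above its tangent.
\<close>
lemma convex_above_tangent_plane:
  fixes f :: "'a::real_inner \<Rightarrow> real"
  assumes convex: "convex_on UNIV f" and grad: "GDERIV f x :> D"
  shows "f y \<ge> f x + (y - x) \<bullet> D"
proof -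
  let ?g = "\<lambda>s::real. f (x + s *\<^sub>R (y - x))"
  have "convex_on UNIV ?g"
  proof (rule convex_onI)
    fix t a b :: real
    assume t: "0 < t" "t < 1"
    have "x + ((1 - t) *\<^sub>R a + t *\<^sub>R b) *\<^sub>R (y - x)
        = (1 - t) *\<^sub>R (x + a *\<^sub>R (y - x)) + t *\<^sub>R (x + b *\<^sub>R (y - x))"
      by (simp add: algebra_simps)
    then show "?g ((1 - t) *\<^sub>R a + t *\<^sub>R b) \<le> (1 - t) * ?g a + t * ?g b"
      using convex_onD[OF convex, of t] t by simp
  qed simp
  moreover have "(?g has_real_derivative (y - x) \<bullet> D) (at 0)"
    using grad
    by (intro GDERIV_has_real_derivative_compose) (auto intro!: derivative_eq_intros)
  ultimately have "?g 1 - ?g 0 \<ge> ((y - x) \<bullet> D) * (1 - 0)"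
    by (intro convex_on_imp_above_tangent[where A = UNIV]) auto
  then show ?thesis by simp
qed

lemma has_vector_derivative_time_deriv:
  assumes "X differentiable_on {T0..}" and "t \<ge> T0"
  shows "(X has_vector_derivative time_deriv T0 X t) (at t within {T0..})"
  using assms unfolding time_deriv_def differentiable_on_def
  by (auto simp: vector_derivative_works)

lemma ode_solutionD:
  assumes "ode_solution \<alpha> p f T0 X" and "t \<ge> T0"
  shows "(X has_vector_derivative time_deriv T0 X t) (at t within {T0..})"
    and "(time_deriv T0 X has_vector_derivative
           - ((p + 1) / t) *\<^sub>R time_deriv T0 X t - ((p + 1) / t powr \<alpha>) *\<^sub>R grad f (X t))
         (at t within {T0..})"
proof -
  show "(X has_vector_derivative time_deriv T0 X t) (at t within {T0..})"
    using assms by (intro has_vector_derivative_time_deriv) (auto simp: ode_solution_def)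
  have "time_deriv T0 (time_deriv T0 X) t
      + (((p + 1) / t) *\<^sub>R time_deriv T0 X t + ((p + 1) / t powr \<alpha>) *\<^sub>R grad f (X t)) = 0"
    using assms by (simp add: ode_solution_def add.assoc)
  then have "time_deriv T0 (time_deriv T0 X) t
      = - ((p + 1) / t) *\<^sub>R time_deriv T0 X t - ((p + 1) / t powr \<alpha>) *\<^sub>R grad f (X t)"
    by (simp add: eq_neg_iff_add_eq_0 [symmetric])
  moreover have "(time_deriv T0 X has_vector_derivative time_deriv T0 (time_deriv T0 X) t)
      (at t within {T0..})"
    using assms by (intro has_vector_derivative_time_deriv) (auto simp: ode_solution_def)
  ultimately show "(time_deriv T0 X has_vector_derivative
      - ((p + 1) / t) *\<^sub>R time_deriv T0 X t - ((p + 1) / t powr \<alpha>) *\<^sub>R grad f (X t))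
      (at t within {T0..})"
    by simp
qed

text \<open>
  The weight \<open>2 (p + 1) t\<^sup>2\<^sup>-\<^sup>\<alpha>\<close> is chosen so that \<open>t X'\<close> contributes to \<open>2 \<langle>V, V'\<rangle>\<close> exactly the
  negative of what \<open>f(X)\<close> contributes through the chain rule; no velocity survives.
  The derivative is one-sided at \<open>T0\<close>, which provides the continuity of the energy up to the
  initial time.
\<close>
lemma energy_has_real_derivative:
  fixes f :: "'a::euclidean_space \<Rightarrow> real"
  assumes diff: "f differentiable (at (X t))"
    and sol: "ode_solution \<alpha> p f T0 X" and T0: "T0 > 0" and t: "t \<ge> T0"
  shows "(energy \<alpha> p f xs T0 X has_real_derivative
           2 * (p + 1) * t powr (1 - \<alpha>)
             * ((2 - \<alpha>) * (f (X t) - f xs) - p * ((X t - xs) \<bullet> grad f (X t))))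
         (at t within {T0..})"
proof -
  let ?S = "{T0..}" and ?X' = "time_deriv T0 X" and ?g = "grad f (X t)"
  let ?V = "\<lambda>t. p *\<^sub>R X t + t *\<^sub>R ?X' t - p *\<^sub>R xs"
  have pos: "t > 0" using T0 t by simp
  have powr: "t powr (2 - \<alpha>) = t * t powr (1 - \<alpha>)" "t / t powr \<alpha> = t powr (1 - \<alpha>)"
    using pos powr_add[of t 1 "1 - \<alpha>"] by (simp_all add: powr_diff)
  note [derivative_intros] = ode_solutionD[OF sol t]
  have V: "(?V has_vector_derivative - ((p + 1) * t powr (1 - \<alpha>)) *\<^sub>R ?g) (at t within ?S)"
  proof -
    have "(?V has_vector_derivative p *\<^sub>R ?X' t
        + (t *\<^sub>R (- ((p + 1) / t) *\<^sub>R ?X' t - ((p + 1) / t powr \<alpha>) *\<^sub>R ?g) + ?X' t))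
        (at t within ?S)"
      by (auto intro!: derivative_eq_intros)
    moreover have "p *\<^sub>R ?X' t
        + (t *\<^sub>R (- ((p + 1) / t) *\<^sub>R ?X' t - ((p + 1) / t powr \<alpha>) *\<^sub>R ?g) + ?X' t)
        = - ((p + 1) * (t / t powr \<alpha>)) *\<^sub>R ?g"
      using pos by (simp add: scaleR_diff_right scaleR_diff_left scaleR_add_left)
    ultimately show ?thesis by (simp only: powr)
  qed
  have sq: "((\<lambda>t. ?V t \<bullet> ?V t) has_real_derivative
      2 * (?V t \<bullet> (- ((p + 1) * t powr (1 - \<alpha>)) *\<^sub>R ?g))) (at t within ?S)"
    using has_derivative_inner[OF V[unfolded has_vector_derivative_def] V[unfolded has_vector_derivative_def]]
    unfolding has_field_derivative_def
    by (rule has_derivative_eq_rhs) (auto simp: inner_commute algebra_simps fun_eq_iff)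
  have fX: "((\<lambda>t. f (X t)) has_real_derivative ?X' t \<bullet> ?g) (at t within ?S)"
    by (intro GDERIV_has_real_derivative_compose GDERIV_grad diff ode_solutionD[OF sol t])
  have pw: "((\<lambda>t. t powr (2 - \<alpha>)) has_real_derivative (2 - \<alpha>) * t powr (1 - \<alpha>)) (at t within ?S)"
    using has_field_derivative_at_within[OF has_real_derivative_powr[OF pos, of "2 - \<alpha>"]] by simp
  have "energy \<alpha> p f xs T0 X = (\<lambda>t. ?V t \<bullet> ?V t + 2 * (p + 1) * t powr (2 - \<alpha>) * (f (X t) - f xs))"
    by (simp add: fun_eq_iff energy_def power2_norm_eq_inner)
  moreover have "((\<lambda>t. ?V t \<bullet> ?V t + 2 * (p + 1) * t powr (2 - \<alpha>) * (f (X t) - f xs))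
      has_real_derivative
        2 * (?V t \<bullet> (- ((p + 1) * t powr (1 - \<alpha>)) *\<^sub>R ?g))
        + (2 * (p + 1) * t powr (2 - \<alpha>) * (?X' t \<bullet> ?g)
           + 2 * (p + 1) * ((2 - \<alpha>) * t powr (1 - \<alpha>)) * (f (X t) - f xs))) (at t within ?S)"
    by (rule derivative_eq_intros sq fX pw refl | simp)+
  moreover have "2 * (?V t \<bullet> (- ((p + 1) * t powr (1 - \<alpha>)) *\<^sub>R ?g))
        + (2 * (p + 1) * t powr (2 - \<alpha>) * (?X' t \<bullet> ?g)
           + 2 * (p + 1) * ((2 - \<alpha>) * t powr (1 - \<alpha>)) * (f (X t) - f xs))
      = 2 * (p + 1) * t powr (1 - \<alpha>)
          * ((2 - \<alpha>) * (f (X t) - f xs) - p * ((X t - xs) \<bullet> ?g))"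
    by (simp add: powr inner_simps algebra_simps)
  ultimately show ?thesis by simp
qed

theorem theorem2:
  fixes f :: "real ^ 'n \<Rightarrow> real"
    and L \<alpha> p T0 T :: real
    and xs :: "real ^ 'n"
    and X :: "real \<Rightarrow> real ^ 'n"
  assumes convex: "convex_on UNIV f"
    and smooth: "L_smooth L f"
    and minimizer: "\<forall>x. f xs \<le> f x"
    and alpha: "\<alpha> \<le> 2"
    and p_alpha: "p + \<alpha> \<ge> 2"
    and T0: "T0 > 0"
    and solution: "ode_solution \<alpha> p f T0 X"
    and T: "T > T0"
  shows "f (X T) - f xs \<le> energy \<alpha> p f xs T0 X T0 / (2 * (p + 1) * T powr (2 - \<alpha>))"
proof -
  let ?E = "energy \<alpha> p f xs T0 X"
  have p: "p \<ge> 0" using alpha p_alpha by simp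
  have diff: "f differentiable (at x)" for x
    using smooth by (simp add: L_smooth_def)
  note deriv = energy_has_real_derivative[OF diff solution T0, of _ xs]
  have "?E T \<le> ?E T0"
  proof (rule DERIV_nonpos_imp_decreasing_open[OF less_imp_le[OF T]])
    fix t assume t: "T0 < t" "t < T"
    have "f (X t) - f xs \<le> (X t - xs) \<bullet> grad f (X t)"
      using convex_above_tangent_plane[OF convex GDERIV_grad[OF diff], of "X t" xs]
      by (simp add: inner_diff_left)
    \<comment> \<open>Both factors are enlarged, which is sound because \<open>p\<close> and \<open>f(X) - f*\<close> are nonnegative.\<close>
    then have "(2 - \<alpha>) * (f (X t) - f xs) \<le> p * ((X t - xs) \<bullet> grad f (X t))"
      using alpha p_alpha minimizer by (intro mult_mono) auto
    then have "2 * (p + 1) * t powr (1 - \<alpha>)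
        * ((2 - \<alpha>) * (f (X t) - f xs) - p * ((X t - xs) \<bullet> grad f (X t))) \<le> 0"
      using p by (intro mult_nonneg_nonpos) auto
    moreover have "at t within {T0..} = at t"
      using t by (intro at_within_interior) simp
    ultimately show "\<exists>y. DERIV ?E t :> y \<and> y \<le> 0"
      using deriv[of t] t by auto
  next
    show "continuous_on {T0..T} ?E"
      using deriv by (intro continuous_on_subset[OF DERIV_continuous_on[of "{T0..}"]]) auto
  qed
  moreover have "2 * (p + 1) * T powr (2 - \<alpha>) * (f (X T) - f xs) \<le> ?E T"
    by (simp add: energy_def)
  ultimately show ?thesis
    using p T T0 by (simp add: pos_le_divide_eq mult.commute)
qed

end
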